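(* Let $0\le\alpha<1$ and $\theta>-\alpha$, and let $X_1,X_2,\dots$ be an exchangeable sequence obtained by i.i.d. sampling from the $\mathsf{GEM}(\alpha,\theta)$ random discrete distribution. For each $n$ let $L_n$ be the number of indices $j\in\{1,\dots,n\}$ with $X_j=\max_{1\le i\le n}X_i$. Then $$\mathbb{P}\bigl[\limsup_{n}L_n=1\bigr]=1\quad\text{if }\alpha>0,\qquad \mathbb{P}\bigl[\limsup_{n}L_n=\infty\bigr]=1\quad\text{if }\alpha=0.$$
   Context: The $\mathsf{GEM}(\alpha,\theta)$ distribution is the law of the random probability distribution $P_\bullet=(P_1,P_2,\dots)$ on $\{1,2,\dots\}$ given by $P_j:=H_j\prod_{i=1}^{j-1}(1-H_i)$ with independent $H_i$, where $H_i$ has the beta$(1-\alpha,\theta+i\alpha)$ distribution. Sampling from $P_\bullet$ means that, conditionally given $P_\bullet$, $X_1,X_2,\dots$ are i.i.d. with $\mathbb{P}(X_i=b\mid P_\bullet)=P_b$. All $L_n$ are defined on the same probability space from the same sequence $(X_i)$. *)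

theory Defs
  imports "HOL-Probability.Probability"
begin

definition beta_density :: "real \<Rightarrow> real \<Rightarrow> real \<Rightarrow> real" where
  "beta_density a b x =
     (if 0 < x \<and> x < 1 then x powr (a - 1) * (1 - x) powr (b - 1) / Beta a b else 0)"

definition beta_measure :: "real \<Rightarrow> real \<Rightarrow> real measure" where
  "beta_measure a b = density lborel (\<lambda>x. ennreal (beta_density a b x))"

text \<open>Random distributions on the positive integers are random elements of the product space
  of real sequences indexed by \<open>{1..}\<close>.\<close>

abbreviation seq_space :: "(nat \<Rightarrow> real) measure" where
  "seq_space \<equiv> PiM {1..} (\<lambda>_. borel)"

definition stick_breaking :: "(nat \<Rightarrow> real) \<Rightarrow> nat \<Rightarrow> real" where
  "stick_breaking h = (\<lambda>j\<in>{1..}. h j * (\<Prod>i\<in>{1..<j}. 1 - h i))"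

text \<open>Independence of the factors \<open>H\<^sub>i\<close> is expressed by the product measure.\<close>

definition GEM :: "real \<Rightarrow> real \<Rightarrow> (nat \<Rightarrow> real) measure" where
  "GEM \<alpha> \<theta> = distr (PiM {1..} (\<lambda>i. beta_measure (1 - \<alpha>) (\<theta> + real i * \<alpha>)))
     seq_space stick_breaking"

definition cond_prob_alg :: "'a measure \<Rightarrow> 'a measure \<Rightarrow> 'a set \<Rightarrow> 'a \<Rightarrow> real" where
  "cond_prob_alg M F A = real_cond_exp M F (indicator A)"

definition cond_indep_vars ::
    "'a measure \<Rightarrow> 'a measure \<Rightarrow> ('i \<Rightarrow> 'b measure) \<Rightarrow> ('i \<Rightarrow> 'a \<Rightarrow> 'b) \<Rightarrow> 'i set \<Rightarrow> bool" where
  "cond_indep_vars M F N X I \<longleftrightarrow>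
     (\<forall>i\<in>I. X i \<in> measurable M (N i)) \<and>
     (\<forall>J\<subseteq>I. finite J \<longrightarrow> J \<noteq> {} \<longrightarrow> (\<forall>A\<in>(\<Pi> j\<in>J. sets (N j)).
        AE \<omega> in M. cond_prob_alg M F (\<Inter>j\<in>J. X j -` A j \<inter> space M) \<omega> =
          (\<Prod>j\<in>J. cond_prob_alg M F (X j -` A j \<inter> space M) \<omega>)))"

text \<open>Conditionally given the \<open>\<sigma>\<close>-algebra generated by \<open>P\<close>, the variables \<open>X\<^sub>1, X\<^sub>2, \<dots>\<close> are
  independent with common conditional distribution \<open>P\<close>.\<close>

definition iid_sampling ::
    "'a measure \<Rightarrow> ('a \<Rightarrow> nat \<Rightarrow> real) \<Rightarrow> (nat \<Rightarrow> 'a \<Rightarrow> nat) \<Rightarrow> bool" where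
  "iid_sampling M P X \<longleftrightarrow>
     (let F = vimage_algebra (space M) P seq_space in
        cond_indep_vars M F (\<lambda>_. count_space {1..}) X {1..} \<and>
        (\<forall>i\<ge>1. \<forall>b\<ge>1. AE \<omega> in M. cond_prob_alg M F (X i -` {b} \<inter> space M) \<omega> = P \<omega> b))"

text \<open>Only \<open>n \<ge> 1\<close> is meaningful; \<open>num_at_max X 0 \<omega> = 0\<close> does not affect limits superior.\<close>

definition num_at_max :: "(nat \<Rightarrow> 'a \<Rightarrow> nat) \<Rightarrow> nat \<Rightarrow> 'a \<Rightarrow> nat" where
  "num_at_max X n \<omega> = card {j \<in> {1..n}. X j \<omega> = Max ((\<lambda>i. X i \<omega>) ` {1..n})}"

end

theory Submission
  imports Defs
begin

text \<open>
  Conditionally on the weights \<open>P\<close>, consider for each value \<open>b\<close> the number \<open>N\<^sub>b\<close> of times that \<open>b\<close> is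
  sampled before anything larger than \<open>b\<close>. Since the samples that are at least \<open>b\<close> are i.i.d. and
  each of them equals \<open>b\<close> with probability \<open>P\<^sub>b / (P\<^sub>b + P\<^sub>b\<^sub>+\<^sub>1 + \<dots>)\<close>, the event \<open>N\<^sub>b \<ge> k\<close> has the \<open>k\<close>-th
  power of this ratio as its probability, and for different \<open>b\<close> these events are independent. For
  weights obtained by stick breaking, the ratio is just \<open>H\<^sub>b\<close>. Because the sequence of samples is
  unbounded, \<open>limsup L\<^sub>n \<ge> k\<close> holds precisely if \<open>N\<^sub>b \<ge> k\<close> for infinitely many \<open>b\<close>.

  Averaging over the independent \<open>H\<^sub>b\<close>, the event \<open>N\<^sub>b \<ge> k\<close> has probability \<open>E H\<^sub>b\<^sup>k\<close>. If \<open>\<alpha> > 0\<close> then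
  \<open>E H\<^sub>b\<^sup>2\<close> is of order \<open>1 / b\<^sup>2\<close>, and by the Borel-Cantelli lemma almost surely only finitely many \<open>N\<^sub>b\<close>
  exceed one. If \<open>\<alpha> = 0\<close> then \<open>E H\<^sub>b\<^sup>k\<close> is positive and does not depend on \<open>b\<close>, and the averaged events are
  still independent, so for every \<open>k\<close> infinitely many of them occur.

  The event \<open>N\<^sub>b \<ge> k\<close> is called \<open>ties_at_record b k\<close> below. Its probabilities come from a recursion on
  the first sample (\<open>prob_ties_at_record_inter\<close>), the passage from conditional independence to a mixture
  of i.i.d. streams is \<open>distr_sample_stream\<close>, and both are combined in \<open>emeasure_sample_stream\<close>.
\<close>

section \<open>Ties at records of a sequence\<close>

text \<open>The maximum of some initial segment of \<open>s\<close> is \<open>b\<close>, attained at least \<open>k\<close> times; equivalently, for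
  \<open>k \<ge> 1\<close>, the first \<open>k\<close> entries of \<open>s\<close> that are at least \<open>b\<close> exist and are all equal to \<open>b\<close>. The empty
  segment is admitted, which makes the case \<open>k = 0\<close> hold for every \<open>b\<close> and serves as the base of
  the recursion on \<open>k\<close>.\<close>

definition ties_at_record :: "nat \<Rightarrow> nat \<Rightarrow> nat stream \<Rightarrow> bool" where
  "ties_at_record b k s \<longleftrightarrow>
     (\<exists>n. (\<forall>i<n. s !! i \<le> b) \<and> k \<le> card {i. i < n \<and> s !! i = b})"

lemma card_hits_Stream:
  "card {i. i < Suc n \<and> (x ## s) !! i = b} =
     (if x = b then 1 else 0) + card {i. i < n \<and> s !! i = b}"
proof -
  have "{i. i < Suc n \<and> (x ## s) !! i = b} =
      (if x = b then {0} else {}) \<union> Suc ` {i. i < n \<and> s !! i = b}" (is "?L = ?R")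
  proof (rule set_eqI)
    fix j show "j \<in> ?L \<longleftrightarrow> j \<in> ?R"
      by (cases j) auto
  qed
  then show ?thesis
    by (auto simp: card_image)
qed

lemma ties_at_record_0 [simp]: "ties_at_record b 0 s"
  unfolding ties_at_record_def by (intro exI[of _ 0]) simp

text \<open>Reading one more sample at the front either changes nothing, uses up one of the required hits,
  or destroys the event. The recursion is what turns independence of the samples into a linear
  equation for probabilities.\<close>

lemma ties_at_record_Stream:
  "ties_at_record b (Suc k) (x ## s) \<longleftrightarrow>
     x < b \<and> ties_at_record b (Suc k) s \<or> x = b \<and> ties_at_record b k s"
proof -
  have *: "(\<exists>n. P n) \<longleftrightarrow> P 0 \<or> (\<exists>n. P (Suc n))" for P :: "nat \<Rightarrow> bool"
    by (metis not0_implies_Suc)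
  have "ties_at_record b (Suc k) (x ## s) \<longleftrightarrow>
     (\<exists>n. (x \<le> b \<and> (\<forall>i<n. s !! i \<le> b)) \<and>
        Suc k \<le> (if x = b then 1 else 0) + card {i. i < n \<and> s !! i = b})"
    unfolding ties_at_record_def by (subst *) (simp add: All_less_Suc2 card_hits_Stream)
  then show ?thesis
    unfolding ties_at_record_def by (cases "x = b") auto
qed

lemma ties_at_record_Stream_less: "x < b \<Longrightarrow> ties_at_record b k (x ## s) = ties_at_record b k s"
  by (cases k) (auto simp: ties_at_record_Stream)

lemma measurable_ties_at_record [measurable]:
  "Measurable.pred (stream_space (count_space UNIV)) (ties_at_record b k)"
proof -
  have "card {i. i < n \<and> s !! i = b} = (\<Sum>i<n. if s !! i = b then 1 else 0)" for n s
    by (simp add: sum.If_cases Int_def)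
  then show ?thesis
    unfolding ties_at_record_def[abs_def] by simp
qed

section \<open>Running maxima and ties\<close>

text \<open>Samples are numbered from 1, stream entries from 0.\<close>

definition sample_stream :: "(nat \<Rightarrow> 'a \<Rightarrow> nat) \<Rightarrow> 'a \<Rightarrow> nat stream" where
  "sample_stream X \<omega> = to_stream (\<lambda>i. X (Suc i) \<omega>)"

lemma sample_stream_nth [simp]: "sample_stream X \<omega> !! i = X (Suc i) \<omega>"
  by (simp add: sample_stream_def to_stream_def)

lemma num_at_max_eq_card_hits:
  assumes "\<forall>i<n. X (Suc i) \<omega> \<le> b" and "\<exists>i<n. X (Suc i) \<omega> = b"
  shows "num_at_max X n \<omega> = card {i. i < n \<and> sample_stream X \<omega> !! i = b}"
proof -
  have img: "{Suc 0..n} = Suc ` {..<n}"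
    by (simp add: image_Suc_lessThan)
  have "Max ((\<lambda>i. X i \<omega>) ` {1..n}) = b"
    using assms by (intro Max_eqI) (auto simp: img image_image)
  then have "{j \<in> {1..n}. X j \<omega> = Max ((\<lambda>i. X i \<omega>) ` {1..n})} =
      Suc ` {i. i < n \<and> sample_stream X \<omega> !! i = b}"
    by (auto simp: img)
  then show ?thesis
    unfolding num_at_max_def by (simp add: card_image)
qed

text \<open>Each record that is tied \<open>k\<close> times produces a time \<open>n\<close> with at least \<open>k\<close> indices at the maximum.
  These times are arbitrarily late, because a record value larger than the first \<open>N\<close> samples can
  only appear after time \<open>N\<close>.\<close>

lemma limsup_num_at_max_eq_infinity:
  assumes inf: "\<And>k m. \<exists>b\<ge>m. ties_at_record b (Suc k) (sample_stream X \<omega>)"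
  shows "limsup (\<lambda>n. enat (num_at_max X n \<omega>)) = \<infinity>"
proof -
  have "enat k \<le> limsup (\<lambda>n. enat (num_at_max X n \<omega>))" for k
    unfolding limsup_INF_SUP
  proof (rule INF_greatest)
    fix N :: nat
    \<comment> \<open>The sum is used as an upper bound; it makes \<open>m\<close> exceed each of the first \<open>N\<close> samples.\<close>
    define m where "m = Suc (\<Sum>i<N. X (Suc i) \<omega>)"
    obtain b n where b: "b \<ge> m" and le: "\<forall>i<n. X (Suc i) \<omega> \<le> b"
      and card: "Suc k \<le> card {i. i < n \<and> sample_stream X \<omega> !! i = b}"
      using inf[of m k] by (auto simp: ties_at_record_def)
    have "{i. i < n \<and> sample_stream X \<omega> !! i = b} \<noteq> {}"
      using card by (metis card.empty not_less_eq_eq zero_le)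
    then obtain i where i: "i < n" "X (Suc i) \<omega> = b"
      by auto
    have "X (Suc j) \<omega> < b" if "j < N" for j
      using member_le_sum[of j "{..<N}" "\<lambda>i. X (Suc i) \<omega>"] that b by (simp add: m_def)
    then have "N \<le> n"
      using i by (metis less_irrefl less_trans not_le)
    moreover have "num_at_max X n \<omega> = card {i. i < n \<and> sample_stream X \<omega> !! i = b}"
      using le i by (intro num_at_max_eq_card_hits) auto
    with card have "enat k \<le> enat (num_at_max X n \<omega>)"
      by simp
    ultimately show "enat k \<le> (SUP n\<in>{N..}. enat (num_at_max X n \<omega>))"
      by (intro SUP_upper2[of n]) auto
  qed
  then show ?thesis
    by (metis enat_ord_code(4) Suc_ile_eq enat_ord_simps(4) not_infinity_eq order_less_irrefl)
qed

text \<open>Once the running maximum has passed the last tied record it is always attained exactly once.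
  Unboundedness is essential: in a bounded sequence the maximal value may be repeated for ever.\<close>

lemma limsup_num_at_max_eq_1:
  assumes unbdd: "\<And>b. \<exists>i. b \<le> sample_stream X \<omega> !! i"
    and fin: "\<And>b. b \<ge> m \<Longrightarrow> \<not> ties_at_record b 2 (sample_stream X \<omega>)"
  shows "limsup (\<lambda>n. enat (num_at_max X n \<omega>)) = 1"
proof -
  obtain i0 where i0: "m \<le> X (Suc i0) \<omega>"
    using unbdd[of m] by auto
  have eq: "num_at_max X n \<omega> = 1" if "n > i0" for n
  proof -
    define b where "b = Max ((\<lambda>i. X (Suc i) \<omega>) ` {..<n})"
    have ne: "(\<lambda>i. X (Suc i) \<omega>) ` {..<n} \<noteq> {}"
      using that by auto
    have le: "\<forall>i<n. X (Suc i) \<omega> \<le> b"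
      unfolding b_def by (intro allI impI Max_ge) auto
    obtain i where i: "i < n" "X (Suc i) \<omega> = b"
      using Max_in[OF _ ne] by (auto simp: b_def)
    let ?C = "{i. i < n \<and> sample_stream X \<omega> !! i = b}"
    have *: "num_at_max X n \<omega> = card ?C"
      using le i by (intro num_at_max_eq_card_hits) auto
    have "b \<ge> m"
      using i0 le that by (meson order_trans)
    then have "\<not> 2 \<le> card ?C"
      using fin[of b] le by (auto simp: ties_at_record_def)
    moreover have "card ?C \<noteq> 0"
      using i by auto
    ultimately show ?thesis
      using * by linarith
  qed
  have "\<forall>\<^sub>F n in sequentially. enat (num_at_max X n \<omega>) = 1"
    using eventually_gt_at_top[of i0] by eventually_elim (simp add: eq one_enat_def)
  then have "limsup (\<lambda>n. enat (num_at_max X n \<omega>)) = limsup (\<lambda>n::nat. 1 :: enat)"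
    by (rule Limsup_eq)
  then show ?thesis
    by (simp add: Limsup_const)
qed

lemma sample_stream_measurable:
  assumes X: "\<And>i. i \<ge> 1 \<Longrightarrow> X i \<in> M \<rightarrow>\<^sub>M count_space {1..}"
  shows "sample_stream X \<in> M \<rightarrow>\<^sub>M stream_space (count_space UNIV)"
proof (rule measurable_stream_space2)
  fix i
  show "(\<lambda>\<omega>. sample_stream X \<omega> !! i) \<in> M \<rightarrow>\<^sub>M count_space UNIV"
    using measurable_compose[OF X[of "Suc i"], of "\<lambda>x. x" "count_space UNIV"] by simp
qed

lemma num_at_max_measurable:
  assumes "\<And>i. i \<ge> 1 \<Longrightarrow> X i \<in> M \<rightarrow>\<^sub>M count_space {1..}"
  shows "num_at_max X n \<in> M \<rightarrow>\<^sub>M count_space UNIV"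
proof -
  have S: "sample_stream X \<in> M \<rightarrow>\<^sub>M stream_space (count_space UNIV)"
    using assms by (rule sample_stream_measurable)
  \<comment> \<open>The statistic is a function of a finite word, and there are only countably many words.\<close>
  define L where "L l = card {j \<in> {1..n}. l ! (j - 1) = Max ((\<lambda>i. l ! (i - 1)) ` {1..n})}"
    for l :: "nat list"
  have "stake n (sample_stream X \<omega>) ! (j - 1) = X j \<omega>" if "j \<in> {1..n}" for j \<omega>
    using that by (cases j) (auto simp: stake_nth)
  then have "num_at_max X n \<omega> = L (stake n (sample_stream X \<omega>))" for \<omega>
    unfolding num_at_max_def L_def
    by (intro arg_cong[where f=card] Collect_cong conj_cong refl arg_cong2[where f="(=)"]
        arg_cong[where f=Max] image_cong) auto
  then have "num_at_max X n = (\<lambda>\<omega>. L (stake n (sample_stream X \<omega>)))"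
    by auto
  moreover have "(\<lambda>\<omega>. L (stake n (sample_stream X \<omega>))) \<in> M \<rightarrow>\<^sub>M count_space UNIV"
    using S by measurable
  ultimately show ?thesis
    by simp
qed

section \<open>Ties in an i.i.d. sequence\<close>

text \<open>The discrete hazard rate: the conditional probability that a sample equals \<open>b\<close> given that it is at
  least \<open>b\<close>. For a stick-breaking distribution it is the fraction broken off at step \<open>b\<close>.\<close>

definition hazard :: "nat pmf \<Rightarrow> nat \<Rightarrow> real" where
  "hazard q b = pmf q b / measure_pmf.prob q {b..}"

lemma measure_pmf_lessThan:
  fixes q :: "nat pmf"
  shows "measure_pmf.prob q {..<b} = 1 - measure_pmf.prob q {b..}"
  by (subst measure_pmf.prob_compl[symmetric]) (auto intro!: arg_cong[where f="measure q"])

lemma measurable_stream_pmf_iff: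
  "Measurable.pred (stream_space (measure_pmf q)) A \<longleftrightarrow>
   Measurable.pred (stream_space (count_space UNIV)) A"
  by (intro arg_cong2[where f="\<lambda>A B. A \<in> B"] refl measurable_cong_sets sets_stream_space_cong) simp_all

lemma space_stream_space_pmf [simp]: "space (stream_space (measure_pmf q)) = UNIV"
  by (simp add: space_stream_space)

text \<open>The core computation. Let \<open>g k\<close> be the probability on the left, and condition on the first sample:
  below \<open>b\<close> it leaves both events as they were, at \<open>b\<close> it lowers \<open>k\<close> by one, above \<open>b\<close> it rules out
  the ties. So \<open>g (Suc k) = q {..<b} * g (Suc k) + q {b} * g k\<close>, and since \<open>q {..<b} < 1\<close> the equation
  can be solved for \<open>g (Suc k)\<close>. Keeping an arbitrary event \<open>A\<close> that ignores leading samples up to \<open>b\<close>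
  yields independence at the same time; ties at records larger than \<open>b\<close> are such events.\<close>

lemma prob_ties_at_record_inter:
  fixes q :: "nat pmf"
  defines "S \<equiv> stream_space (measure_pmf q)"
  assumes A [measurable]: "Measurable.pred (stream_space (count_space UNIV)) A"
    and inv: "\<And>x s. x \<le> b \<Longrightarrow> A (x ## s) = A s"
    and pos: "measure_pmf.prob q {b..} > 0"
  shows "measure S {s. ties_at_record b k s \<and> A s} = hazard q b ^ k * measure S {s. A s}"
proof (induction k)
  case (Suc k)
  interpret S: prob_space S
    unfolding S_def by (rule prob_space.prob_space_stream_space[OF prob_space_measure_pmf])
  define G where "G k = {s. ties_at_record b k s \<and> A s}" for k
  have sets_G: "G k \<in> sets S" for k
  proof -
    have "Measurable.pred S (\<lambda>s. ties_at_record b k s \<and> A s)"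
      unfolding S_def measurable_stream_pmf_iff by measurable
    from predE[OF this] show ?thesis
      by (simp add: G_def S_def)
  qed
  have "emeasure S (G (Suc k)) =
      (\<integral>\<^sup>+x. emeasure S {s \<in> space S. x ## s \<in> G (Suc k)} \<partial>measure_pmf q)"
    using sets_G unfolding S_def by (intro prob_space.emeasure_stream_space[OF prob_space_measure_pmf])
  also have "\<dots> = (\<integral>\<^sup>+x. emeasure S (G (Suc k)) * indicator {..<b} x +
      emeasure S (G k) * indicator {b} x \<partial>measure_pmf q)"
  proof (intro nn_integral_cong)
    fix x
    consider "x < b" | "x = b" | "x > b" by linarith
    then show "emeasure S {s \<in> space S. x ## s \<in> G (Suc k)} =
        emeasure S (G (Suc k)) * indicator {..<b} x + emeasure S (G k) * indicator {b} x"
      by cases (auto simp: G_def ties_at_record_Stream inv S_def)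
  qed
  also have "\<dots> = emeasure S (G (Suc k)) * emeasure q {..<b} + emeasure S (G k) * emeasure q {b}"
    by (simp add: nn_integral_add nn_integral_cmult)
  finally have "measure S (G (Suc k)) =
      measure S (G (Suc k)) * measure q {..<b} + measure S (G k) * pmf q b"
    by (simp add: S.emeasure_eq_measure measure_pmf.emeasure_eq_measure measure_pmf_single
        flip: ennreal_mult ennreal_plus)
  moreover have "measure q {..<b} = 1 - measure q {b..}"
    by (rule measure_pmf_lessThan)
  ultimately have "measure S (G (Suc k)) * measure q {b..} = measure S (G k) * pmf q b"
    by (simp add: algebra_simps)
  then have "measure S (G (Suc k)) = hazard q b * measure S (G k)"
    using pos by (simp add: hazard_def field_simps)
  then show ?case
    using Suc.IH by (simp add: G_def)
qed simp

lemma prob_ties_at_record: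
  assumes "measure_pmf.prob q {b..} > 0"
  shows "measure (stream_space (measure_pmf q)) {s. ties_at_record b k s} = hazard q b ^ k"
  using prob_ties_at_record_inter[of "\<lambda>_. True" b q k]
    prob_space.prob_space[OF prob_space.prob_space_stream_space[OF prob_space_measure_pmf[of q]]] assms by simp

text \<open>Ties at different records are independent: removing the smallest element of \<open>F\<close>, the event for the
  remaining ones does not see samples up to that element.\<close>

lemma prob_no_ties_at_records:
  fixes q :: "nat pmf"
  defines "S \<equiv> stream_space (measure_pmf q)"
  assumes "finite F" and pos: "\<And>b. measure_pmf.prob q {b..} > 0"
  shows "measure S {s. \<forall>b\<in>F. \<not> ties_at_record b k s} = (\<Prod>b\<in>F. 1 - hazard q b ^ k)"
  using \<open>finite F\<close>
proof (induction F rule: finite_linorder_min_induct)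
  case empty
  show ?case
    using prob_space.prob_space[OF prob_space.prob_space_stream_space[OF prob_space_measure_pmf[of q]]] by (simp add: S_def)
next
  case (insert b F)
  interpret S: prob_space S
    unfolding S_def by (rule prob_space.prob_space_stream_space[OF prob_space_measure_pmf])
  define A where "A s \<longleftrightarrow> (\<forall>c\<in>F. \<not> ties_at_record c k s)" for s
  have A: "Measurable.pred (stream_space (count_space UNIV)) A"
    unfolding A_def using \<open>finite F\<close> by measurable
  have inv: "A (x ## s) = A s" if "x \<le> b" for x s
    unfolding A_def using insert.hyps that by (intro ball_cong refl) (auto simp: ties_at_record_Stream_less)
  have *: "measure S {s. ties_at_record b k s \<and> A s} = hazard q b ^ k * measure S {s. A s}"
    using prob_ties_at_record_inter[OF A inv pos] by (simp add: S_def)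
  have sets: "{s. A s} \<in> sets S" "{s. ties_at_record b k s \<and> A s} \<in> sets S"
  proof -
    have "Measurable.pred S A" "Measurable.pred S (\<lambda>s. ties_at_record b k s \<and> A s)"
      unfolding S_def measurable_stream_pmf_iff using A by measurable
    from this[THEN predE] show "{s. A s} \<in> sets S" "{s. ties_at_record b k s \<and> A s} \<in> sets S"
      by (simp_all add: S_def)
  qed
  have "measure S {s. \<forall>c\<in>insert b F. \<not> ties_at_record c k s} =
      measure S ({s. A s} - {s. ties_at_record b k s \<and> A s})"
    by (rule arg_cong[where f="measure S"]) (auto simp: A_def)
  also have "\<dots> = (1 - hazard q b ^ k) * measure S {s. A s}"
    using sets by (subst S.finite_measure_Diff) (auto simp: * algebra_simps)
  finally show ?case
    using insert by (subst prod.insert) (auto simp: A_def)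
qed

text \<open>The event that all samples are below \<open>b\<close> has a probability \<open>x\<close> with \<open>x = x * q {..<b}\<close>,
  as the first sample and the remaining ones show, and \<open>q {..<b} < 1\<close>.\<close>

lemma AE_stream_unbounded:
  fixes q :: "nat pmf"
  assumes "measure_pmf.prob q {b..} > 0"
  shows "AE s in stream_space (measure_pmf q). \<exists>i. b \<le> s !! i"
proof -
  let ?S = "stream_space (measure_pmf q)"
  interpret S: prob_space ?S
    by (rule prob_space.prob_space_stream_space[OF prob_space_measure_pmf])
  define B where "B = {s. \<forall>i. s !! i < b}"
  have "Measurable.pred ?S (\<lambda>s. \<forall>i. s !! i < b)"
    unfolding measurable_stream_pmf_iff by measurable
  from predE[OF this] have B: "B \<in> sets ?S"
    by (simp add: B_def)
  have "emeasure ?S B = (\<integral>\<^sup>+x. emeasure ?S {s \<in> space ?S. x ## s \<in> B} \<partial>measure_pmf q)"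
    by (rule prob_space.emeasure_stream_space[OF prob_space_measure_pmf B])
  also have "\<dots> = (\<integral>\<^sup>+x. emeasure ?S B * indicator {..<b} x \<partial>measure_pmf q)"
  proof (intro nn_integral_cong)
    have *: "(\<forall>n. P n) \<longleftrightarrow> P 0 \<and> (\<forall>n. P (Suc n))" for P :: "nat \<Rightarrow> bool"
      by (metis not0_implies_Suc)
    fix x
    have "x ## s \<in> B \<longleftrightarrow> x < b \<and> s \<in> B" for s
      by (simp add: B_def) (subst *, simp)
    then show "emeasure ?S {s \<in> space ?S. x ## s \<in> B} = emeasure ?S B * indicator {..<b} x"
      by (auto split: split_indicator)
  qed
  also have "\<dots> = emeasure ?S B * emeasure q {..<b}"
    by (simp add: nn_integral_cmult)
  finally have "measure ?S B = measure ?S B * measure q {..<b}"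
    by (simp add: S.emeasure_eq_measure measure_pmf.emeasure_eq_measure flip: ennreal_mult)
  moreover have "measure q {..<b} = 1 - measure q {b..}"
    by (rule measure_pmf_lessThan)
  ultimately have "measure ?S B = 0"
    using assms by (simp add: algebra_simps)
  then have "emeasure ?S B = 0"
    by (simp add: S.emeasure_eq_measure)
  with B have "AE s in ?S. s \<notin> B"
    by (intro AE_not_in) auto
  then show ?thesis
    by eventually_elim (auto simp: B_def not_less)
qed

section \<open>Mixtures of i.i.d. sequences\<close>

text \<open>Weights are indexed from 1, hence the shift by one.\<close>

definition proper :: "(nat \<Rightarrow> real) \<Rightarrow> bool" where
  "proper p \<longleftrightarrow> (\<forall>b. 0 \<le> p (Suc b)) \<and> (\<Sum>b. ennreal (p (Suc b))) = 1"

text \<open>The value on improper weights is arbitrary: almost surely it does not occur, but totality makes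
  the sampling kernel a measurable function on the whole space of weights.\<close>

definition weights_pmf :: "(nat \<Rightarrow> real) \<Rightarrow> nat pmf" where
  "weights_pmf p =
     (if proper p then embed_pmf (\<lambda>b. if b = 0 then 0 else p b) else return_pmf 1)"

lemma measurable_proper [measurable]: "Measurable.pred seq_space proper"
proof -
  have [measurable]: "(\<lambda>p. p (Suc b)) \<in> borel_measurable seq_space" for b
    by (rule measurable_component_singleton) simp
  show ?thesis
    unfolding proper_def[abs_def] by measurable
qed

lemma pmf_weights_pmf:
  "proper p \<Longrightarrow> pmf (weights_pmf p) b = (if b = 0 then 0 else p b)"
proof -
  assume p: "proper p"
  let ?f = "\<lambda>b. if b = 0 then 0 else p b"
  have nonneg: "0 \<le> ?f b" for b
    using p by (cases b) (auto simp: proper_def)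
  have "(\<integral>\<^sup>+b. ennreal (?f b) \<partial>count_space UNIV) = (\<Sum>b. ennreal (?f b))"
    by (rule nn_integral_count_space_nat)
  also have "\<dots> = (\<Sum>b. ennreal (?f (b + 1))) + (\<Sum>b<1. ennreal (?f b))"
    by (rule suminf_offset) simp
  also have "\<dots> = 1"
    using p by (simp add: proper_def)
  finally show ?thesis
    using nonneg p by (simp add: weights_pmf_def pmf_embed_pmf)
qed

lemma measurable_pmf_weights_pmf [measurable]:
  "(\<lambda>p. pmf (weights_pmf p) b) \<in> borel_measurable seq_space"
proof -
  have [measurable]: "(\<lambda>p. if b = 0 then 0 else p b) \<in> borel_measurable seq_space"
    by (cases b) (auto intro!: measurable_component_singleton)
  have "(\<lambda>p. if proper p then (if b = 0 then 0 else p b) else pmf (return_pmf 1) b)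
      \<in> borel_measurable seq_space"
    by measurable
  moreover have "(\<lambda>p. if proper p then (if b = 0 then 0 else p b) else pmf (return_pmf 1) b) =
      (\<lambda>p. pmf (weights_pmf p) b)"
    proof
    fix p show "(if proper p then (if b = 0 then 0 else p b) else pmf (return_pmf 1) b) =
        pmf (weights_pmf p) b"
      by (cases "proper p") (simp add: pmf_weights_pmf, simp add: weights_pmf_def)
  qed
  ultimately show ?thesis
    by simp
qed

lemma measurable_prod_weights_pmf [measurable]:
  "(\<lambda>p. \<Prod>x\<leftarrow>xs. pmf (weights_pmf p) x) \<in> borel_measurable seq_space"
proof (induction xs)
  case (Cons x xs)
  note [measurable] = Cons.IH
  show ?case
    unfolding list.map prod_list.Cons by measurable
qed simp

lemma emeasure_stream_space_sstart:
  "emeasure (stream_space (measure_pmf q)) (sstart UNIV xs) = ennreal (\<Prod>x\<leftarrow>xs. pmf q x)"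
proof (induction xs)
  case Nil
  show ?case
    using prob_space.emeasure_space_1[OF prob_space.prob_space_stream_space[OF prob_space_measure_pmf, of q]]
    by simp
next
  case (Cons x xs)
  let ?S = "stream_space (measure_pmf q)"
  have sets: "sstart UNIV ys \<in> sets ?S" for ys
    using sets_sstart[of UNIV ys] sets_stream_space_cong[of "measure_pmf q" "count_space UNIV"] by simp
  have "emeasure ?S (sstart UNIV (x # xs)) =
      (\<integral>\<^sup>+t. emeasure ?S {s \<in> space ?S. t ## s \<in> sstart UNIV (x # xs)} \<partial>measure_pmf q)"
    by (rule prob_space.emeasure_stream_space[OF prob_space_measure_pmf sets])
  also have "\<dots> = (\<integral>\<^sup>+t. emeasure ?S (sstart UNIV xs) * indicator {x} t \<partial>measure_pmf q)"
    by (intro nn_integral_cong) (auto split: split_indicator)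
  also have "\<dots> = emeasure ?S (sstart UNIV xs) * ennreal (pmf q x)"
    by (simp add: nn_integral_cmult emeasure_pmf_single)
  also have "\<dots> = ennreal (\<Prod>x\<leftarrow>x # xs. pmf q x)"
    by (simp add: Cons.IH mult.commute ennreal_mult' pmf_nonneg)
  finally show ?case .
qed

abbreviation sampling_kernel :: "(nat \<Rightarrow> real) \<Rightarrow> nat stream measure" where
  "sampling_kernel p \<equiv> stream_space (measure_pmf (weights_pmf p))"

lemma measurable_sampling_kernel:
  "sampling_kernel \<in> seq_space \<rightarrow>\<^sub>M prob_algebra (stream_space (count_space UNIV))"
proof (rule measurable_prob_algebra_generated[OF _ Int_stable_sstart])
  show "sets (stream_space (count_space UNIV)) =
      sigma_sets (streams UNIV) (sstart UNIV ` lists UNIV \<union> {{} :: nat stream set})"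
    by (subst sets_stream_space_sstart) (auto simp: sets_measure_of)
  fix A :: "nat stream set" assume "A \<in> sstart UNIV ` lists UNIV \<union> {{}}"
  then consider "A = {}" | xs where "A = sstart UNIV xs"
    by auto
  then show "(\<lambda>p. emeasure (sampling_kernel p) A) \<in> borel_measurable seq_space"
  proof cases
    case (2 xs)
    show ?thesis
      unfolding 2 emeasure_stream_space_sstart by measurable
  qed simp
qed (auto intro!: prob_space.prob_space_stream_space prob_space_measure_pmf sets_stream_space_cong)

text \<open>The law of total probability for a version \<open>f\<close> of the conditional probability.\<close>

lemma emeasure_eq_nn_integral_cond_prob:
  assumes M: "prob_space M" and P: "P \<in> M \<rightarrow>\<^sub>M N" and E: "E \<in> sets M"
    and cond: "AE \<omega> in M. cond_prob_alg M (vimage_algebra (space M) P N) E \<omega> = f \<omega>"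
    and nonneg: "AE \<omega> in M. 0 \<le> f \<omega>"
  shows "emeasure M E = (\<integral>\<^sup>+\<omega>. ennreal (f \<omega>) \<partial>M)"
proof -
  interpret M: prob_space M by fact
  let ?F = "vimage_algebra (space M) P N"
  interpret F: sigma_finite_subalgebra M ?F
  proof (rule finite_measure_subalgebra_is_sigma_finite, unfold_locales)
    show "subalgebra M ?F"
      unfolding subalgebra_def
      using P by (auto simp: sets_vimage_algebra2 measurable_space dest: measurable_sets)
  qed
  have int: "integrable M (indicator E :: _ \<Rightarrow> real)"
    using E by (simp add: integrable_indicator_iff less_top[symmetric])
  have "emeasure M E = ennreal (\<integral>\<omega>. indicator E \<omega> \<partial>M)"
    using E by (simp add: M.emeasure_eq_measure)
  also have "\<dots> = ennreal (\<integral>\<omega>. cond_prob_alg M ?F E \<omega> \<partial>M)"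
    unfolding cond_prob_alg_def by (simp only: F.real_cond_exp_int(2)[OF int])
  also have "\<dots> = (\<integral>\<^sup>+\<omega>. ennreal (cond_prob_alg M ?F E \<omega>) \<partial>M)"
  proof (rule nn_integral_eq_integral[symmetric])
    show "integrable M (cond_prob_alg M ?F E)"
      unfolding cond_prob_alg_def by (rule F.real_cond_exp_int(1)[OF int])
    show "AE \<omega> in M. 0 \<le> cond_prob_alg M ?F E \<omega>"
      using cond nonneg by eventually_elim simp
  qed
  also have "\<dots> = (\<integral>\<^sup>+\<omega>. ennreal (f \<omega>) \<partial>M)"
    using cond by (intro nn_integral_cong_AE) auto
  finally show ?thesis .
qed

text \<open>Conditional independence determines the law of the samples: it is the mixture, over the random
  weights, of the laws of i.i.d. sequences. Streams are determined in law by their cylinder sets, and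
  on the cylinder of the finite word \<open>xs\<close> both sides are the expected product of the weights of the
  letters.\<close>

lemma distr_sample_stream:
  assumes M: "prob_space M" and P [measurable]: "P \<in> M \<rightarrow>\<^sub>M seq_space"
    and proper: "AE \<omega> in M. proper (P \<omega>)"
    and iid: "iid_sampling M P X"
  shows "distr M (stream_space (count_space UNIV)) (sample_stream X) =
    distr M seq_space P \<bind> sampling_kernel"
proof -
  interpret M: prob_space M by fact
  let ?S = "stream_space (count_space UNIV) :: nat stream measure"
  let ?F = "vimage_algebra (space M) P seq_space"
  let ?PM = "distr M seq_space P"
  have X: "X i \<in> M \<rightarrow>\<^sub>M count_space {1..}" if "i \<ge> 1" for i
    using iid that by (auto simp: iid_sampling_def cond_indep_vars_def Let_def)
  note [measurable] = sample_stream_measurable[of X M, OF X]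
  have PM: "?PM \<in> space (prob_algebra seq_space)"
    using M.prob_space_distr[OF P] by (simp add: space_prob_algebra)
  show ?thesis
  proof (rule stream_space_eq_sstart[where S=UNIV])
    show "prob_space (distr M ?S (sample_stream X))"
      by (rule M.prob_space_distr) measurable
    show "prob_space (?PM \<bind> sampling_kernel)"
      by (rule prob_space_bind'[OF PM measurable_sampling_kernel])
    show "sets (?PM \<bind> sampling_kernel) = sets ?S"
      by (rule sets_bind'[OF PM measurable_sampling_kernel])
    fix xs :: "nat list" assume "xs \<noteq> []"
    let ?J = "{1..length xs}"
    let ?E = "\<lambda>j. X j -` {xs ! (j - 1)} \<inter> space M"
    have rhs: "emeasure (?PM \<bind> sampling_kernel) (sstart UNIV xs) =
        (\<integral>\<^sup>+\<omega>. ennreal (\<Prod>x\<leftarrow>xs. pmf (weights_pmf (P \<omega>)) x) \<partial>M)"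
      by (simp add: emeasure_bind_prob_algebra[OF PM measurable_sampling_kernel]
          emeasure_stream_space_sstart nn_integral_distr del: One_nat_def)
    have lhs: "emeasure (distr M ?S (sample_stream X)) (sstart UNIV xs) = emeasure M (\<Inter>j\<in>?J. ?E j)"
    proof (subst emeasure_distr)
      have "(\<forall>i<length xs. X (Suc i) \<omega> = xs ! i) \<longleftrightarrow> (\<forall>j\<in>?J. X j \<omega> = xs ! (j - 1))" for \<omega>
        by (auto simp: Suc_le_eq) (metis Suc_le_eq Suc_pred less_eq_Suc_le)
      then show "emeasure M (sample_stream X -` sstart UNIV xs \<inter> space M) = emeasure M (\<Inter>j\<in>?J. ?E j)"
        using \<open>xs \<noteq> []\<close> by (intro arg_cong[where f="emeasure M"]) (auto simp: sstart_eq Suc_le_eq)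
    qed auto
    have sets: "?E j \<in> sets M" if "j \<ge> 1" for j
    proof (cases "xs ! (j - 1) = 0")
      case True
      then have "?E j = {}"
        using X[OF that] by (auto dest: measurable_space)
      then show ?thesis by simp
    qed (use X[OF that] in \<open>auto intro!: measurable_sets\<close>)
    show "emeasure (distr M ?S (sample_stream X)) (sstart UNIV xs) =
        emeasure (?PM \<bind> sampling_kernel) (sstart UNIV xs)"
    \<comment> \<open>The value 0 is outside the range of the samples and has weight 0.\<close>
    proof (cases "0 \<in> set xs")
      case True
      then obtain i where i: "i < length xs" "xs ! i = 0"
        by (auto simp: in_set_conv_nth)
      then have "?E (Suc i) = {}"
        using X[of "Suc i"] by (auto dest: measurable_space)
      moreover have "(\<Inter>j\<in>?J. ?E j) \<subseteq> ?E (Suc i)"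
        using i by (intro INF_lower) auto
      ultimately have "(\<Inter>j\<in>?J. ?E j) = {}"
        by simp
      moreover have "(\<integral>\<^sup>+\<omega>. ennreal (\<Prod>x\<leftarrow>xs. pmf (weights_pmf (P \<omega>)) x) \<partial>M) = (\<integral>\<^sup>+\<omega>. 0 \<partial>M)"
      proof (rule nn_integral_cong_AE)
        show "AE \<omega> in M. ennreal (\<Prod>x\<leftarrow>xs. pmf (weights_pmf (P \<omega>)) x) = 0"
          using proper
        proof eventually_elim
          case (elim \<omega>)
          have "0 \<in> set (map (pmf (weights_pmf (P \<omega>))) xs)"
            using True elim by (force simp: pmf_weights_pmf)
          then have "(\<Prod>x\<leftarrow>xs. pmf (weights_pmf (P \<omega>)) x) = 0"
            by (simp only: prod_list_zero_iff)
          then show ?case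
            by (simp only: ennreal_0)
        qed
      qed
      ultimately show ?thesis
        unfolding lhs rhs by (simp only: emeasure_empty nn_integral_const mult_zero_left)
    next
      case False
      then have pos: "xs ! (j - 1) \<ge> 1" if "j \<in> ?J" for j
      proof -
        have "xs ! (j - 1) \<in> set xs"
          using that by (intro nth_mem) auto
        with False show ?thesis
          by (cases "xs ! (j - 1)") auto
      qed
      have AE_inter: "AE \<omega> in M. cond_prob_alg M ?F (\<Inter>j\<in>?J. ?E j) \<omega> =
          (\<Prod>j\<in>?J. cond_prob_alg M ?F (?E j) \<omega>)"
      proof -
        have "\<forall>J\<subseteq>{1..}. finite J \<longrightarrow> J \<noteq> {} \<longrightarrow> (\<forall>A\<in>(\<Pi> j\<in>J. sets (count_space {1..})).
            AE \<omega> in M. cond_prob_alg M ?F (\<Inter>j\<in>J. X j -` A j \<inter> space M) \<omega> =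
              (\<Prod>j\<in>J. cond_prob_alg M ?F (X j -` A j \<inter> space M) \<omega>))"
          using iid unfolding iid_sampling_def cond_indep_vars_def Let_def by (elim conjE)
        from this[rule_format, of ?J "\<lambda>j. {xs ! (j - 1)}"] show ?thesis
          using \<open>xs \<noteq> []\<close> pos by (auto simp: Suc_le_eq)
      qed
      have AE_single: "AE \<omega> in M. cond_prob_alg M ?F (?E j) \<omega> = P \<omega> (xs ! (j - 1))" if "j \<in> ?J" for j
        using iid that pos[OF that] by (auto simp: iid_sampling_def Let_def)
      have AE: "AE \<omega> in M. cond_prob_alg M ?F (\<Inter>j\<in>?J. ?E j) \<omega> =
          (\<Prod>x\<leftarrow>xs. pmf (weights_pmf (P \<omega>)) x)"
      proof -
        have "AE \<omega> in M. \<forall>j\<in>?J. cond_prob_alg M ?F (?E j) \<omega> = P \<omega> (xs ! (j - 1))"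
          using AE_single by (intro AE_finite_allI) auto
        then show ?thesis
          using AE_inter proper
        proof eventually_elim
          case (elim \<omega>)
          have "(\<Prod>x\<leftarrow>xs. pmf (weights_pmf (P \<omega>)) x) =
              (\<Prod>i<length xs. pmf (weights_pmf (P \<omega>)) (xs ! i))"
            by (simp add: prod.list_conv_set_nth atLeast0LessThan)
          also have "\<dots> = (\<Prod>j\<in>?J. pmf (weights_pmf (P \<omega>)) (xs ! (j - 1)))"
            by (rule prod.reindex_bij_witness[of _ "\<lambda>j. j - 1" Suc]) auto
          also have "\<dots> = (\<Prod>j\<in>?J. cond_prob_alg M ?F (?E j) \<omega>)"
            using elim pos by (intro prod.cong) (force simp: pmf_weights_pmf)+
          finally show ?case
            using elim by simp
        qed
      qed
      have E: "(\<Inter>j\<in>?J. ?E j) \<in> sets M"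
        using sets \<open>xs \<noteq> []\<close> by (intro sets.finite_INT) (auto simp: Suc_le_eq)
      have "emeasure M (\<Inter>j\<in>?J. ?E j) = (\<integral>\<^sup>+\<omega>. ennreal (\<Prod>x\<leftarrow>xs. pmf (weights_pmf (P \<omega>)) x) \<partial>M)"
        by (rule emeasure_eq_nn_integral_cond_prob[OF M P E AE])
          (intro AE_I2 prod_list_nonneg, auto)
      then show ?thesis
        unfolding lhs rhs .
    qed
  qed auto
qed

text \<open>The weights sum to at most one, and the expectation of their sum is \<open>\<Sum>b. P(X\<^sub>1 = b) = 1\<close>; so they sum
  to one almost surely. For stick-breaking weights this means that the remaining stick length tends
  to zero.\<close>

lemma AE_proper_weights:
  assumes M: "prob_space M" and P [measurable]: "P \<in> M \<rightarrow>\<^sub>M seq_space"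
    and iid: "iid_sampling M P X"
    and subprob: "AE \<omega> in M. (\<forall>b. 0 \<le> P \<omega> (Suc b)) \<and> (\<Sum>b. ennreal (P \<omega> (Suc b))) \<le> 1"
  shows "AE \<omega> in M. proper (P \<omega>)"
proof -
  interpret M: prob_space M by fact
  let ?F = "vimage_algebra (space M) P seq_space"
  have X: "X 1 \<in> M \<rightarrow>\<^sub>M count_space {1..}"
    using iid by (auto simp: iid_sampling_def cond_indep_vars_def Let_def)
  let ?E = "\<lambda>b. X 1 -` {Suc b} \<inter> space M"
  have sets: "?E b \<in> sets M" for b
    using X by (auto intro!: measurable_sets)
  have [measurable]: "(\<lambda>\<omega>. P \<omega> (Suc b)) \<in> borel_measurable M" for b
    using measurable_compose[OF P measurable_component_singleton[of "Suc b" "{1..}" "\<lambda>_. borel"]] by simp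
  have *: "emeasure M (?E b) = (\<integral>\<^sup>+\<omega>. ennreal (P \<omega> (Suc b)) \<partial>M)" for b
    by (rule emeasure_eq_nn_integral_cond_prob[OF M P sets])
      (use iid subprob in \<open>auto simp: iid_sampling_def Let_def\<close>)
  let ?s = "\<lambda>\<omega>. \<Sum>b. ennreal (P \<omega> (Suc b))"
  have "(\<integral>\<^sup>+\<omega>. ?s \<omega> \<partial>M) = (\<Sum>b. emeasure M (?E b))"
    by (simp add: * nn_integral_suminf del: One_nat_def)
  also have "\<dots> = emeasure M (\<Union>b. ?E b)"
    using sets by (intro suminf_emeasure) (auto simp: disjoint_family_on_def)
  also have "(\<Union>b. ?E b) = space M"
  proof (rule antisym; clarsimp)
    fix \<omega> assume "\<omega> \<in> space M"
    then have "X 1 \<omega> \<in> space (count_space {1..})"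
      by (rule measurable_space[OF X])
    then show "\<exists>b. X (Suc 0) \<omega> = Suc b"
      by (cases "X (Suc 0) \<omega>") auto
  qed
  finally have s: "(\<integral>\<^sup>+\<omega>. ?s \<omega> \<partial>M) = 1"
    by (simp add: M.emeasure_space_1)
  have "(\<integral>\<^sup>+\<omega>. 1 - ?s \<omega> \<partial>M) = (\<integral>\<^sup>+\<omega>. 1 \<partial>M) - (\<integral>\<^sup>+\<omega>. ?s \<omega> \<partial>M)"
    using subprob s by (intro nn_integral_diff) auto
  then have "(\<integral>\<^sup>+\<omega>. 1 - ?s \<omega> \<partial>M) = 0"
    by (simp add: s M.emeasure_space_1)
  then have "AE \<omega> in M. 1 - ?s \<omega> = 0"
    by (subst (asm) nn_integral_0_iff_AE) auto
  then show ?thesis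
    using subprob by eventually_elim (auto simp: proper_def diff_eq_0_iff_ennreal intro!: antisym)
qed

section \<open>Beta distributions and their products\<close>

lemma beta_density_measurable [measurable]: "beta_density a b \<in> borel_measurable borel"
  unfolding beta_density_def[abs_def] by measurable

lemma sets_beta_measure [simp, measurable_cong]: "sets (beta_measure a b) = sets borel"
  by (simp add: beta_measure_def)

lemma AE_beta_measure: "AE x in beta_measure a b. 0 < x \<and> x < 1"
  unfolding beta_measure_def by (subst AE_density) (auto simp: beta_density_def)

lemma Beta_real_pos: "a > 0 \<Longrightarrow> b > 0 \<Longrightarrow> Beta a b > (0::real)"
  by (simp add: Beta_def)

lemma nn_integral_beta_measure_power:
  assumes "a > 0" "b > 0"
  shows "(\<integral>\<^sup>+x. ennreal (x ^ k) \<partial>beta_measure a b) = ennreal (Beta (a + real k) b / Beta a b)"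
proof -
  let ?f = "\<lambda>x. x powr (a + real k - 1) * (1 - x) powr (b - 1) / Beta a b"
  have "(\<integral>\<^sup>+x. ennreal (x ^ k) \<partial>beta_measure a b) =
      (\<integral>\<^sup>+x. ennreal (beta_density a b x) * ennreal (x ^ k) \<partial>lborel)"
    unfolding beta_measure_def by (subst nn_integral_density) simp_all
  also have "\<dots> = (\<integral>\<^sup>+x. ennreal (?f x) * indicator {0<..<1} x \<partial>lborel)"
  proof (intro nn_integral_cong)
    fix x :: real
    have "beta_density a b x * x ^ k = ?f x" if "0 < x" "x < 1"
    proof -
      have "x powr (a - 1) * x ^ k = x powr (a + real k - 1)"
        using that by (simp add: powr_realpow[symmetric] powr_add[symmetric] algebra_simps)
      then show ?thesis
        using that by (simp add: beta_density_def mult_ac)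
    qed
    then show "ennreal (beta_density a b x) * ennreal (x ^ k) = ennreal (?f x) * indicator {0<..<1} x"
      by (cases "0 < x \<and> x < 1") (auto simp: beta_density_def simp flip: ennreal_mult'' simp del: times_divide_eq_left)
  qed
  also have "\<dots> = ennreal (Beta (a + real k) b / Beta a b)"
  proof (rule nn_integral_has_integral_lebesgue')
    show "(?f has_integral Beta (a + real k) b / Beta a b) {0<..<1}"
      using has_integral_Beta_real[of "a + real k" b] assms
      by (intro has_integral_divide) (simp add: has_integral_Icc_iff_Ioo)
    show "0 \<le> ?f x" if "x \<in> {0<..<1}" for x
      using Beta_real_pos[OF assms] by simp
  qed
  finally show ?thesis .
qed

lemma prob_space_beta_measure: "a > 0 \<Longrightarrow> b > 0 \<Longrightarrow> prob_space (beta_measure a b)"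
  using nn_integral_beta_measure_power[of a b 0] Beta_real_pos[of a b]
  by (intro prob_spaceI) simp

lemma nn_integral_beta_measure_square:
  assumes "a > 0" "b > 0"
  shows "(\<integral>\<^sup>+x. ennreal (x ^ 2) \<partial>beta_measure a b) =
    ennreal (a * (a + 1) / ((a + b) * (a + b + 1)))"
proof -
  have pos: "c \<notin> \<int>\<^sub>\<le>\<^sub>0" if "c > 0" for c :: real
    using that nonpos_Ints_nonpos not_le by blast
  have 1: "(a + b) * Beta (a + 1) b = a * Beta a b"
    using assms by (intro Beta_plus1_left pos)
  have 2: "(a + 1 + b) * Beta (a + 1 + 1) b = (a + 1) * Beta (a + 1) b"
    using assms by (intro Beta_plus1_left pos) simp
  have "Beta (a + 2) b * ((a + b) * (a + b + 1)) = (a + b) * ((a + 1 + b) * Beta (a + 1 + 1) b)"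
    by (simp add: mult_ac add_ac)
  also have "\<dots> = a * (a + 1) * Beta a b"
    unfolding 2 using 1 by (metis mult.commute mult.left_commute)
  finally have "Beta (a + real 2) b / Beta a b = a * (a + 1) / ((a + b) * (a + b + 1))"
    using Beta_real_pos[OF assms] assms by (simp add: divide_simps)
  then show ?thesis
    by (simp only: nn_integral_beta_measure_power[OF assms])
qed

text \<open>The integral and the positive moment of order \<open>k\<close> add up to one.\<close>

lemma nn_integral_beta_measure_one_minus_power_less:
  assumes "a > 0" "b > 0" "k > 0"
  shows "(\<integral>\<^sup>+x. ennreal (1 - x ^ k) \<partial>beta_measure a b) < 1"
proof -
  interpret prob_space "beta_measure a b"
    using assms by (intro prob_space_beta_measure)
  define c where "c = (\<integral>\<^sup>+x. ennreal (1 - x ^ k) \<partial>beta_measure a b)"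
  define \<mu> where "\<mu> = Beta (a + real k) b / Beta a b"
  have "\<mu> > 0"
    using assms by (simp add: \<mu>_def Beta_real_pos)
  have "c + ennreal \<mu> = (\<integral>\<^sup>+x. ennreal (1 - x ^ k) + ennreal (x ^ k) \<partial>beta_measure a b)"
    unfolding c_def \<mu>_def using assms
    by (subst nn_integral_add) (simp_all add: nn_integral_beta_measure_power)
  also have "\<dots> = (\<integral>\<^sup>+x. 1 \<partial>beta_measure a b)"
  proof (rule nn_integral_cong_AE)
    show "AE x in beta_measure a b. ennreal (1 - x ^ k) + ennreal (x ^ k) = 1"
      using AE_beta_measure
      by eventually_elim (simp add: power_le_one flip: ennreal_plus)
  qed
  finally have *: "c + ennreal \<mu> = 1"
    using emeasure_space_1 by simp
  show ?thesis
  proof (rule ccontr)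
    assume "\<not> ?thesis"
    then have "1 + ennreal \<mu> \<le> c + ennreal \<mu>"
      by (intro add_right_mono) (simp add: c_def not_less)
    then have "ennreal (1 + \<mu>) \<le> ennreal 1"
      using \<open>\<mu> > 0\<close> by (simp add: *)
    then show False
      using \<open>\<mu> > 0\<close> by (subst (asm) ennreal_le_iff) auto
  qed
qed

text \<open>Only the coordinates in \<open>F\<close> matter, so the integral is one over a finite product.\<close>

lemma nn_integral_PiM_prod:
  assumes "\<And>i. i \<in> I \<Longrightarrow> prob_space (N i)" and "finite F" "F \<subseteq> I"
    and [measurable]: "\<And>i. i \<in> F \<Longrightarrow> f i \<in> borel_measurable (N i)"
  shows "(\<integral>\<^sup>+x. (\<Prod>i\<in>F. f i (x i)) \<partial>PiM I N) = (\<Prod>i\<in>F. \<integral>\<^sup>+x. f i x \<partial>N i)"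
proof -
  \<comment> \<open>Restriction to finitely many coordinates is stated for families of probability measures over
    all indices, so the family is completed outside \<open>I\<close>, where it does not affect the product.\<close>
  define N' where "N' i = (if i \<in> I then N i else return (count_space UNIV) undefined)" for i
  interpret N': product_prob_space N' I
    by (intro product_prob_spaceI) (auto simp: N'_def assms intro: prob_space_return)
  have "(\<integral>\<^sup>+x. (\<Prod>i\<in>F. f i (x i)) \<partial>PiM I N) = (\<integral>\<^sup>+x. (\<Prod>i\<in>F. f i (x i)) \<partial>PiM I N')"
    by (rule arg_cong2[where f=nn_integral]) (auto intro!: PiM_cong simp: N'_def)
  also have "\<dots> = (\<integral>\<^sup>+x. (\<Prod>i\<in>F. f i (restrict x F i)) \<partial>PiM I N')"
    by simp
  also have "\<dots> = (\<integral>\<^sup>+x. (\<Prod>i\<in>F. f i (x i)) \<partial>distr (PiM I N') (PiM F N') (\<lambda>x. restrict x F))"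
  proof (rule nn_integral_distr[symmetric])
    show "(\<lambda>x. restrict x F) \<in> PiM I N' \<rightarrow>\<^sub>M PiM F N'"
      by (rule measurable_restrict_subset[OF \<open>F \<subseteq> I\<close>])
    have [measurable]: "f i \<in> borel_measurable (N' i)" if "i \<in> F" for i
      using that \<open>F \<subseteq> I\<close> by (auto simp: N'_def)
    show "(\<lambda>x. \<Prod>i\<in>F. f i (x i)) \<in> borel_measurable (distr (PiM I N') (PiM F N') (\<lambda>x. restrict x F))"
      by (simp only: measurable_distr_eq1) measurable
  qed
  also have "\<dots> = (\<integral>\<^sup>+x. (\<Prod>i\<in>F. f i (x i)) \<partial>PiM F N')"
    by (subst N'.distr_PiM_restrict_finite[OF assms(2,3)]) simp
  also have "\<dots> = (\<Prod>i\<in>F. \<integral>\<^sup>+x. f i x \<partial>N' i)"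
    using assms by (intro N'.product_nn_integral_prod) (auto simp: N'_def)
  also have "\<dots> = (\<Prod>i\<in>F. \<integral>\<^sup>+x. f i x \<partial>N i)"
    using \<open>F \<subseteq> I\<close> by (intro prod.cong) (auto simp: N'_def)
  finally show ?thesis .
qed

section \<open>Stick breaking\<close>

abbreviation stick_measure :: "real \<Rightarrow> real \<Rightarrow> (nat \<Rightarrow> real) measure" where
  "stick_measure \<alpha> \<theta> \<equiv> PiM {1..} (\<lambda>i. beta_measure (1 - \<alpha>) (\<theta> + real i * \<alpha>))"

lemma GEM_parameter_pos:
  assumes "0 \<le> \<alpha>" "\<theta> > - \<alpha>" "i \<in> {1..}"
  shows "\<theta> + real i * \<alpha> > 0"
proof -
  have "1 * \<alpha> \<le> real i * \<alpha>"
    using assms by (intro mult_right_mono) auto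
  then show ?thesis
    using assms by simp
qed

lemma prob_space_beta_factor:
  assumes "0 \<le> \<alpha>" "\<alpha> < 1" "\<theta> > - \<alpha>" "i \<in> {1..}"
  shows "prob_space (beta_measure (1 - \<alpha>) (\<theta> + real i * \<alpha>))"
  using assms GEM_parameter_pos[of \<alpha> \<theta> i] by (intro prob_space_beta_measure) auto

lemma AE_stick_measure:
  assumes "0 \<le> \<alpha>" "\<alpha> < 1" "\<theta> > - \<alpha>"
  shows "AE h in stick_measure \<alpha> \<theta>. \<forall>i\<in>{1..}. 0 < h i \<and> h i < 1"
  using assms
  by (intro AE_ball_countable[THEN iffD2] ballI AE_PiM_component prob_space_beta_factor AE_beta_measure)
     auto

lemma measurable_stick_breaking [measurable]:
  "stick_breaking \<in> stick_measure \<alpha> \<theta> \<rightarrow>\<^sub>M seq_space"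
proof -
  have comp: "(\<lambda>h. h i) \<in> borel_measurable (stick_measure \<alpha> \<theta>)" if "i \<in> {1..}" for i
  proof -
    have "(\<lambda>h. h i) \<in> stick_measure \<alpha> \<theta> \<rightarrow>\<^sub>M beta_measure (1 - \<alpha>) (\<theta> + real i * \<alpha>)"
      using that by (rule measurable_component_singleton)
    then show ?thesis
      by (simp cong: measurable_cong_sets)
  qed
  show ?thesis
    unfolding stick_breaking_def[abs_def] using comp
    by (intro measurable_restrict borel_measurable_times borel_measurable_prod borel_measurable_diff
        borel_measurable_const) auto
qed

lemma sum_stick_breaking:
  "(\<Sum>j\<in>{1..<b}. stick_breaking h j) = 1 - (\<Prod>i\<in>{1..<b}. 1 - h i)"
proof (induction b)
  case (Suc b)
  show ?case
  proof (cases "b = 0")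
    case False
    then have "{1..<Suc b} = insert b {1..<b}"
      by auto
    then show ?thesis
      using Suc.IH False by (simp add: stick_breaking_def algebra_simps)
  qed simp
qed simp

lemma stick_breaking_subprob:
  assumes h: "\<forall>i\<in>{1..}. 0 < h i \<and> h i < 1"
  shows "(\<forall>b. 0 \<le> stick_breaking h (Suc b)) \<and> (\<Sum>b. ennreal (stick_breaking h (Suc b))) \<le> 1"
proof -
  have prod: "0 < (\<Prod>i\<in>{1..<b}. 1 - h i)" for b
    using h by (intro prod_pos) auto
  have nonneg: "0 \<le> stick_breaking h (Suc b)" for b
    using h prod[of "Suc b"] by (auto simp: stick_breaking_def less_imp_le)
  have "(\<Sum>b<n. ennreal (stick_breaking h (Suc b))) \<le> 1" for n
  proof -
    have "(\<Sum>b<n. ennreal (stick_breaking h (Suc b))) = ennreal (\<Sum>b<n. stick_breaking h (Suc b))"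
      using nonneg by (intro sum_ennreal) auto
    also have "(\<Sum>b<n. stick_breaking h (Suc b)) = (\<Sum>j\<in>{1..<Suc n}. stick_breaking h j)"
      by (rule sum.reindex_bij_witness[of _ "\<lambda>j. j - 1" Suc]) auto
    also have "ennreal \<dots> \<le> 1"
      unfolding sum_stick_breaking using prod[of "Suc n"] by (simp add: ennreal_le_1)
    finally show ?thesis .
  qed
  then show ?thesis
    using nonneg by (auto intro!: suminf_le_const)
qed

lemma prob_atLeast_stick_breaking:
  assumes "proper (stick_breaking h)"
  shows "measure_pmf.prob (weights_pmf (stick_breaking h)) {b..} = (\<Prod>i\<in>{1..<b}. 1 - h i)"
proof -
  let ?q = "weights_pmf (stick_breaking h)"
  have "measure_pmf.prob ?q {b..} = 1 - measure_pmf.prob ?q {..<b}"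
    using measure_pmf_lessThan[of ?q b] by simp
  also have "measure_pmf.prob ?q {..<b} = (\<Sum>j<b. pmf ?q j)"
    by (rule measure_measure_pmf_finite) simp
  also have "\<dots> = (\<Sum>j\<in>{1..<b}. stick_breaking h j)"
    using assms by (intro sum.mono_neutral_cong_right) (auto simp: pmf_weights_pmf)
  finally show ?thesis
    by (simp only: sum_stick_breaking)
qed

lemma prob_atLeast_stick_breaking_pos:
  assumes "proper (stick_breaking h)" and "\<forall>i\<in>{1..}. 0 < h i \<and> h i < 1"
  shows "0 < measure_pmf.prob (weights_pmf (stick_breaking h)) {b..}"
  unfolding prob_atLeast_stick_breaking[OF assms(1)] using assms(2) by (intro prod_pos) auto

text \<open>The product of the remaining stick lengths cancels, so the hazard rates of a stick-breaking
  distribution are the independent beta variables themselves.\<close>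

lemma hazard_stick_breaking:
  assumes "proper (stick_breaking h)" and "\<forall>i\<in>{1..}. 0 < h i \<and> h i < 1" and "b \<ge> 1"
  shows "hazard (weights_pmf (stick_breaking h)) b = h b"
proof -
  have "pmf (weights_pmf (stick_breaking h)) b = h b * (\<Prod>i\<in>{1..<b}. 1 - h i)"
    using assms by (simp add: pmf_weights_pmf stick_breaking_def)
  moreover have "(\<Prod>i\<in>{1..<b}. 1 - h i) \<noteq> 0"
    using prob_atLeast_stick_breaking_pos[OF assms(1,2), of b]
    unfolding prob_atLeast_stick_breaking[OF assms(1)] by (rule less_imp_neq[symmetric])
  ultimately show ?thesis
    unfolding hazard_def prob_atLeast_stick_breaking[OF assms(1)]
    by (metis nonzero_mult_div_cancel_right)
qed

section \<open>Samples from the GEM distribution\<close>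

context
  fixes M :: "'a measure" and P :: "'a \<Rightarrow> nat \<Rightarrow> real" and X :: "nat \<Rightarrow> 'a \<Rightarrow> nat"
    and \<alpha> \<theta> :: real
  assumes alpha: "0 \<le> \<alpha>" "\<alpha> < 1" and theta: "\<theta> > - \<alpha>"
    and M: "prob_space M"
    and P: "P \<in> measurable M seq_space"
    and GEM: "distr M seq_space P = GEM \<alpha> \<theta>"
    and iid: "iid_sampling M P X"
begin

lemma measurable_X: "i \<ge> 1 \<Longrightarrow> X i \<in> M \<rightarrow>\<^sub>M count_space {1..}"
  using iid by (auto simp: iid_sampling_def cond_indep_vars_def Let_def)

lemma measurable_sample_stream: "sample_stream X \<in> M \<rightarrow>\<^sub>M stream_space (count_space UNIV)"
  by (rule sample_stream_measurable) (rule measurable_X)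

lemma AE_proper_GEM: "AE p in GEM \<alpha> \<theta>. proper p"
proof -
  let ?sub = "\<lambda>p :: nat \<Rightarrow> real. (\<forall>b. 0 \<le> p (Suc b)) \<and> (\<Sum>b. ennreal (p (Suc b))) \<le> 1"
  have [measurable]: "(\<lambda>p. p (Suc b)) \<in> borel_measurable seq_space" for b
    by (rule measurable_component_singleton) simp
  have sub: "Measurable.pred seq_space ?sub"
    by measurable
  have "AE h in stick_measure \<alpha> \<theta>. ?sub (stick_breaking h)"
    using AE_stick_measure[OF alpha theta] by eventually_elim (rule stick_breaking_subprob)
  then have "AE p in GEM \<alpha> \<theta>. ?sub p"
    unfolding GEM_def using AE_distr_iff[OF measurable_stick_breaking predE[OF sub]]
    by (rule iffD2[rotated])
  then have "AE \<omega> in M. ?sub (P \<omega>)"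
    unfolding GEM[symmetric] by (rule AE_distrD[OF P])
  from AE_proper_weights[OF M P iid this] show ?thesis
    unfolding GEM[symmetric] using AE_distr_iff[OF P predE[OF measurable_proper]] by (rule iffD2[rotated])
qed

lemma AE_proper_stick_breaking: "AE h in stick_measure \<alpha> \<theta>. proper (stick_breaking h)"
  using AE_proper_GEM unfolding GEM_def by (rule AE_distrD[OF measurable_stick_breaking])

text \<open>Probabilities of events for the samples are averages, over independent beta variables \<open>h\<close>, of
  probabilities for an i.i.d. sequence from fixed weights. This separates the combinatorics of a
  fixed weight sequence from the computation of beta moments.\<close>

lemma emeasure_sample_stream:
  assumes A: "Measurable.pred (stream_space (count_space UNIV)) A"
    and f: "\<And>h. proper (stick_breaking h) \<Longrightarrow> \<forall>i\<in>{1..}. 0 < h i \<and> h i < 1 \<Longrightarrow>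
      emeasure (sampling_kernel (stick_breaking h)) {s. A s} = f h"
  shows "emeasure M {\<omega> \<in> space M. A (sample_stream X \<omega>)} = (\<integral>\<^sup>+h. f h \<partial>stick_measure \<alpha> \<theta>)"
proof -
  interpret M: prob_space M by fact
  let ?S = "stream_space (count_space UNIV) :: nat stream measure"
  have proper: "AE \<omega> in M. proper (P \<omega>)"
    using AE_proper_GEM unfolding GEM[symmetric] by (rule AE_distrD[OF P])
  have A': "{s. A s} \<in> sets ?S"
    using predE[OF A] by (simp add: space_stream_space)
  have PM: "distr M seq_space P \<in> space (prob_algebra seq_space)"
    using M.prob_space_distr[OF P] by (simp add: space_prob_algebra)
  have kernel: "(\<lambda>p. emeasure (sampling_kernel p) {s. A s}) \<in> borel_measurable seq_space"
    using measurable_emeasure_kernel[OF measurable_prob_algebraD[OF measurable_sampling_kernel] A'] .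
  have "emeasure M {\<omega> \<in> space M. A (sample_stream X \<omega>)} =
      emeasure (distr M ?S (sample_stream X)) {s. A s}"
    using measurable_sample_stream A'
    by (subst emeasure_distr) (auto intro!: arg_cong[where f="emeasure M"])
  also have "\<dots> = (\<integral>\<^sup>+p. emeasure (sampling_kernel p) {s. A s} \<partial>GEM \<alpha> \<theta>)"
    unfolding distr_sample_stream[OF M P proper iid]
    by (subst emeasure_bind_prob_algebra[OF PM measurable_sampling_kernel A']) (simp only: GEM)
  also have "\<dots> = (\<integral>\<^sup>+h. emeasure (sampling_kernel (stick_breaking h)) {s. A s} \<partial>stick_measure \<alpha> \<theta>)"
    unfolding GEM_def using kernel
    by (intro nn_integral_distr measurable_stick_breaking) (simp del: One_nat_def)
  also have "\<dots> = (\<integral>\<^sup>+h. f h \<partial>stick_measure \<alpha> \<theta>)"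
    using AE_proper_stick_breaking AE_stick_measure[OF alpha theta]
    by (intro nn_integral_cong_AE, eventually_elim) (rule f)
  finally show ?thesis .
qed

lemma AE_sample_stream_unbounded: "AE \<omega> in M. \<forall>b. \<exists>i. b \<le> sample_stream X \<omega> !! i"
proof (subst AE_all_countable, intro allI)
  fix b
  let ?A = "\<lambda>s :: nat stream. \<not> (\<exists>i. b \<le> s !! i)"
  have A: "Measurable.pred (stream_space (count_space UNIV)) ?A"
    by measurable
  have "emeasure M {\<omega> \<in> space M. ?A (sample_stream X \<omega>)} = (\<integral>\<^sup>+h. 0 \<partial>stick_measure \<alpha> \<theta>)"
  proof (rule emeasure_sample_stream[OF A])
    fix h :: "nat \<Rightarrow> real"
    assume "proper (stick_breaking h)" "\<forall>i\<in>{1..}. 0 < h i \<and> h i < 1"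
    from AE_stream_unbounded[OF prob_atLeast_stick_breaking_pos[OF this]]
    have "AE s in sampling_kernel (stick_breaking h). \<exists>i. b \<le> s !! i" .
    moreover have "Measurable.pred (sampling_kernel (stick_breaking h)) ?A"
      unfolding measurable_stream_pmf_iff by (rule A)
    from predE[OF this] have "{s. ?A s} \<in> sets (sampling_kernel (stick_breaking h))"
      by simp
    ultimately show "emeasure (sampling_kernel (stick_breaking h)) {s. ?A s} = 0"
      using AE_iff_measurable[of "{s. ?A s}" "sampling_kernel (stick_breaking h)" "\<lambda>s. \<exists>i. b \<le> s !! i"]
      by simp
  qed
  then show "AE \<omega> in M. \<exists>i. b \<le> sample_stream X \<omega> !! i"
    using measurable_compose[OF measurable_sample_stream A]
    by (subst AE_iff_measurable[OF _ refl]) (auto dest!: predE)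
qed

lemma emeasure_ties_at_record:
  assumes "b \<ge> 1"
  shows "emeasure M {\<omega> \<in> space M. ties_at_record b k (sample_stream X \<omega>)} =
    (\<integral>\<^sup>+x. ennreal (x ^ k) \<partial>beta_measure (1 - \<alpha>) (\<theta> + real b * \<alpha>))"
proof -
  have "emeasure M {\<omega> \<in> space M. ties_at_record b k (sample_stream X \<omega>)} =
      (\<integral>\<^sup>+h. (\<Prod>i\<in>{b}. ennreal (h i ^ k)) \<partial>stick_measure \<alpha> \<theta>)"
  proof (rule emeasure_sample_stream[OF measurable_ties_at_record])
    fix h :: "nat \<Rightarrow> real"
    assume h: "proper (stick_breaking h)" "\<forall>i\<in>{1..}. 0 < h i \<and> h i < 1"
    interpret S: prob_space "sampling_kernel (stick_breaking h)"
      by (rule prob_space.prob_space_stream_space[OF prob_space_measure_pmf])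
    show "emeasure (sampling_kernel (stick_breaking h)) {s. ties_at_record b k s} =
        (\<Prod>i\<in>{b}. ennreal (h i ^ k))"
      using prob_ties_at_record[OF prob_atLeast_stick_breaking_pos[OF h]]
        hazard_stick_breaking[OF h assms]
      by (simp add: S.emeasure_eq_measure)
  qed
  also have "\<dots> = (\<Prod>i\<in>{b}. \<integral>\<^sup>+x. ennreal (x ^ k) \<partial>beta_measure (1 - \<alpha>) (\<theta> + real i * \<alpha>))"
    using alpha theta assms by (intro nn_integral_PiM_prod prob_space_beta_factor) auto
  finally show ?thesis
    by simp
qed

lemma emeasure_no_ties_at_records:
  assumes "finite F" "F \<subseteq> {1..}"
  shows "emeasure M {\<omega> \<in> space M. \<forall>b\<in>F. \<not> ties_at_record b k (sample_stream X \<omega>)} =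
    (\<Prod>b\<in>F. \<integral>\<^sup>+x. ennreal (1 - x ^ k) \<partial>beta_measure (1 - \<alpha>) (\<theta> + real b * \<alpha>))"
proof -
  have "emeasure M {\<omega> \<in> space M. \<forall>b\<in>F. \<not> ties_at_record b k (sample_stream X \<omega>)} =
      (\<integral>\<^sup>+h. (\<Prod>b\<in>F. ennreal (1 - h b ^ k)) \<partial>stick_measure \<alpha> \<theta>)"
  proof (rule emeasure_sample_stream)
    show "Measurable.pred (stream_space (count_space UNIV)) (\<lambda>s. \<forall>b\<in>F. \<not> ties_at_record b k s)"
      using assms by measurable
    fix h :: "nat \<Rightarrow> real"
    assume h: "proper (stick_breaking h)" "\<forall>i\<in>{1..}. 0 < h i \<and> h i < 1"
    interpret S: prob_space "sampling_kernel (stick_breaking h)"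
      by (rule prob_space.prob_space_stream_space[OF prob_space_measure_pmf])
    have "(\<Prod>b\<in>F. 1 - hazard (weights_pmf (stick_breaking h)) b ^ k) = (\<Prod>b\<in>F. 1 - h b ^ k)"
      using assms by (intro prod.cong) (auto simp: hazard_stick_breaking[OF h])
    moreover have "0 \<le> 1 - h b ^ k" if "b \<in> F" for b
      using h(2) assms that by (auto intro!: power_le_one simp: less_imp_le subset_eq)
    ultimately show "emeasure (sampling_kernel (stick_breaking h)) {s. \<forall>b\<in>F. \<not> ties_at_record b k s} =
        (\<Prod>b\<in>F. ennreal (1 - h b ^ k))"
      using prob_no_ties_at_records[OF \<open>finite F\<close> prob_atLeast_stick_breaking_pos[OF h]]
      by (simp add: S.emeasure_eq_measure prod_ennreal)
  qed
  also have "\<dots> = (\<Prod>b\<in>F. \<integral>\<^sup>+x. ennreal (1 - x ^ k) \<partial>beta_measure (1 - \<alpha>) (\<theta> + real b * \<alpha>))"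
    using alpha theta assms by (intro nn_integral_PiM_prod prob_space_beta_factor) auto
  finally show ?thesis .
qed

text \<open>A record value \<open>b\<close> is hit at least twice before it is exceeded with probability \<open>E H\<^sub>b\<^sup>2\<close>,
  which is of order \<open>1 / b\<^sup>2\<close> because the second beta parameter grows linearly in \<open>b\<close>. So almost surely
  only finitely many records are tied.\<close>

lemma AE_limsup_eq_1:
  assumes "\<alpha> > 0"
  shows "AE \<omega> in M. limsup (\<lambda>n. enat (num_at_max X n \<omega>)) = 1"
proof -
  interpret M: prob_space M by fact
  \<comment> \<open>The index is shifted since the summable bound is \<open>1 / n\<^sup>2\<close> for record \<open>n + 1\<close>.\<close>
  define T where "T n = {\<omega> \<in> space M. ties_at_record (Suc n) 2 (sample_stream X \<omega>)}" for n
  have T: "T n \<in> sets M" for n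
    unfolding T_def
    using predE[OF measurable_compose[OF measurable_sample_stream measurable_ties_at_record]] .
  have T_le: "measure M (T n) \<le> 2 / \<alpha>\<^sup>2 * inverse (real n ^ 2)" if "n \<ge> 1" for n
  proof -
    define a where "a = 1 - \<alpha>"
    define b where "b = \<theta> + real (Suc n) * \<alpha>"
    have pos: "a > 0" "b > 0"
      using alpha theta GEM_parameter_pos[of \<alpha> \<theta> "Suc n"] by (auto simp: a_def b_def)
    have "measure M (T n) = a * (a + 1) / ((a + b) * (a + b + 1))"
      using nn_integral_beta_measure_square[OF pos] emeasure_ties_at_record[of "Suc n" 2] pos
      by (simp add: T_def a_def b_def measure_def)
    also have "\<dots> \<le> (1 * 2) / ((real n * \<alpha>) * (real n * \<alpha>))"
    proof (rule frac_le)
      show "a * (a + 1) \<le> 1 * 2"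
        using alpha by (intro mult_mono) (auto simp: a_def)
      have "real n * \<alpha> \<le> a + b"
        using alpha theta by (simp add: a_def b_def algebra_simps)
      then show "real n * \<alpha> * (real n * \<alpha>) \<le> (a + b) * (a + b + 1)"
        using alpha pos by (intro mult_mono) auto
      show "0 < real n * \<alpha> * (real n * \<alpha>)"
        using that assms by simp
    qed simp
    also have "\<dots> = 2 / \<alpha>\<^sup>2 * inverse (real n ^ 2)"
      by (simp add: power2_eq_square divide_simps)
    finally show ?thesis .
  qed
  have "summable (\<lambda>n. measure M (T n))"
  proof (rule summable_comparison_test'[where N=1])
    show "summable (\<lambda>n. 2 / \<alpha>\<^sup>2 * inverse (real n ^ 2))"
      by (intro summable_mult inverse_power_summable) simp
  qed (use T_le in auto)
  then have "AE \<omega> in M. \<forall>\<^sub>F n in sequentially. \<omega> \<in> space M - T n"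
    using T by (intro borel_cantelli_AE1) (auto simp: less_top[symmetric])
  then show ?thesis
    using AE_sample_stream_unbounded
  proof eventually_elim
    case (elim \<omega>)
    then obtain m where m: "\<And>n. n \<ge> m \<Longrightarrow> \<omega> \<in> space M - T n"
      by (auto simp: eventually_sequentially)
    show ?case
    proof (rule limsup_num_at_max_eq_1[where m="Suc m"])
      fix b assume "Suc m \<le> b"
      then show "\<not> ties_at_record b 2 (sample_stream X \<omega>)"
        using m[of "b - 1"] by (auto simp: T_def)
    qed (use elim in auto)
  qed
qed

text \<open>For \<open>\<alpha> = 0\<close> all \<open>H\<^sub>b\<close> have the same law, and averaging over them keeps the ties at different
  records independent. Hence none of \<open>r\<close> consecutive values is hit \<open>k\<close> times at a record with
  probability \<open>c ^ r\<close>, where the constant \<open>c = E (1 - H\<^sup>k)\<close> is less than 1.\<close>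

lemma AE_limsup_eq_infinity:
  assumes "\<alpha> = 0"
  shows "AE \<omega> in M. limsup (\<lambda>n. enat (num_at_max X n \<omega>)) = \<infinity>"
proof -
  interpret M: prob_space M by fact
  have "AE \<omega> in M. \<exists>b\<ge>m. ties_at_record b (Suc k) (sample_stream X \<omega>)" for k m
  proof -
    define c where "c = enn2real (\<integral>\<^sup>+x. ennreal (1 - x ^ Suc k) \<partial>beta_measure 1 \<theta>)"
    have c: "(\<integral>\<^sup>+x. ennreal (1 - x ^ Suc k) \<partial>beta_measure 1 \<theta>) < 1"
      using theta assms by (intro nn_integral_beta_measure_one_minus_power_less) auto
    then have c_eq: "ennreal c = (\<integral>\<^sup>+x. ennreal (1 - x ^ Suc k) \<partial>beta_measure 1 \<theta>)"
      unfolding c_def by (intro ennreal_enn2real) (auto simp: top_unique intro: less_trans)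
    have c_less: "0 \<le> c" "c < 1"
      using c unfolding c_eq[symmetric] by (auto simp: c_def ennreal_less_one_iff)
    define N where "N = {\<omega> \<in> space M. \<forall>b\<ge>m. \<not> ties_at_record b (Suc k) (sample_stream X \<omega>)}"
    have pred: "Measurable.pred (stream_space (count_space UNIV))
        (\<lambda>s. \<forall>b\<ge>m. \<not> ties_at_record b (Suc k) s)"
      by measurable
    have N: "N \<in> sets M"
      unfolding N_def using predE[OF measurable_compose[OF measurable_sample_stream pred]] .
    have le: "measure M N \<le> c ^ r" for r
    proof -
      let ?F = "{Suc m..m + r}"
      let ?A = "{\<omega> \<in> space M. \<forall>b\<in>?F. \<not> ties_at_record b (Suc k) (sample_stream X \<omega>)}"
      have "Measurable.pred (stream_space (count_space UNIV)) (\<lambda>s. \<forall>b\<in>?F. \<not> ties_at_record b (Suc k) s)"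
        by measurable
      then have "?A \<in> sets M"
        using predE[OF measurable_compose[OF measurable_sample_stream]] by blast
      then have "emeasure M N \<le> emeasure M ?A"
        by (intro emeasure_mono) (auto simp: N_def)
      also have "\<dots> = ennreal c ^ r"
        using assms by (subst emeasure_no_ties_at_records) (auto simp: c_eq)
      also have "\<dots> = ennreal (c ^ r)"
        using c_less by (simp add: ennreal_power)
      finally show ?thesis
        using c_less by (simp add: M.emeasure_eq_measure)
    qed
    have "(\<lambda>r. c ^ r) \<longlonglongrightarrow> 0"
      using c_less by (intro LIMSEQ_power_zero) auto
    from LIMSEQ_le_const[OF this] le have "measure M N \<le> 0"
      by blast
    then have "emeasure M N = 0"
      by (simp add: M.emeasure_eq_measure measure_le_0_iff)
    with N have "AE \<omega> in M. \<omega> \<notin> N"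
      by (intro AE_not_in) auto
    then show ?thesis
      using AE_space by eventually_elim (auto simp: N_def)
  qed
  then have "AE \<omega> in M. \<forall>k m. \<exists>b\<ge>m. ties_at_record b (Suc k) (sample_stream X \<omega>)"
    by (simp add: AE_all_countable)
  then show ?thesis
    by eventually_elim (rule limsup_num_at_max_eq_infinity, blast)
qed

lemma prob_limsup_eq:
  assumes "AE \<omega> in M. limsup (\<lambda>n. enat (num_at_max X n \<omega>)) = l"
  shows "\<P>(\<omega> in M. limsup (\<lambda>n. enat (num_at_max X n \<omega>)) = l) = 1"
proof -
  interpret M: prob_space M by fact
  have "(\<lambda>\<omega>. enat (num_at_max X n \<omega>)) \<in> borel_measurable M" for n
    by (rule measurable_compose[OF num_at_max_measurable[OF measurable_X]]) simp_all
  then have "(\<lambda>\<omega>. limsup (\<lambda>n. enat (num_at_max X n \<omega>))) \<in> borel_measurable M"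
    by (rule borel_measurable_limsup)
  then have "{\<omega> \<in> space M. limsup (\<lambda>n. enat (num_at_max X n \<omega>)) = l} \<in> sets M"
    by measurable
  then show ?thesis
    using assms by (simp add: M.prob_Collect_eq_1)
qed

end

theorem theorem7p3:
  fixes M :: "'a measure" and P :: "'a \<Rightarrow> nat \<Rightarrow> real" and X :: "nat \<Rightarrow> 'a \<Rightarrow> nat"
    and \<alpha> \<theta> :: real
  assumes "0 \<le> \<alpha>" and "\<alpha> < 1" and "\<theta> > - \<alpha>"
    and "prob_space M"
    and "P \<in> measurable M seq_space"
    and "distr M seq_space P = GEM \<alpha> \<theta>"
    and "iid_sampling M P X"
  shows "(\<alpha> > 0 \<longrightarrow> \<P>(\<omega> in M. limsup (\<lambda>n. enat (num_at_max X n \<omega>)) = 1) = 1) \<and>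
         (\<alpha> = 0 \<longrightarrow> \<P>(\<omega> in M. limsup (\<lambda>n. enat (num_at_max X n \<omega>)) = \<infinity>) = 1)"
  using prob_limsup_eq[OF assms AE_limsup_eq_1[OF assms]]
    prob_limsup_eq[OF assms AE_limsup_eq_infinity[OF assms]] by blast

end
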